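(* Let $\alpha<0$ be real, let $n\ge N_\alpha$ be an integer, and let $j$ be even with $4\le j\le n$. Then the function $x\mapsto d_{n,j}+\frac{\eta_\alpha(x)}{n}$ is a contraction on the closed interval $[d_{n,j-1},d_{n,j}]$, and its fixed point is $z_{\alpha,n,j}$.
   Context: For an integer $n\ge3$ and real $\alpha<0$, $L_{\alpha,n}$ is the real symmetric $n\times n$ matrix whose entries are: $(1,1)$ and $(n,n)$ entries equal to $1+\alpha$; $(1,n)$ and $(n,1)$ entries equal to $-\alpha$; $(k,k)$ entries equal to $2$ for $2\le k\le n-1$; $(k,k+1)$ and $(k+1,k)$ entries equal to $-1$ for $1\le k\le n-1$; all other entries $0$. Its eigenvalues, counted with multiplicity, are $\lambda_{\alpha,n,1}\le\dots\le\lambda_{\alpha,n,n}$. Put $\varkappa_\alpha=\frac{\alpha-1}{\alpha}$, $N_\alpha=\max\{3,\lfloor\varkappa_\alpha\rfloor+1\}$, $d_{n,j}=\frac{(j-1)\pi}{n}$, and $\eta_\alpha(x)=2\arctan\left(\varkappa_\alpha\tan\frac{x}{2}\right)-\pi$ for $x\in[0,\pi]$ (with $\eta_\alpha(\pi)=0$ by continuity). For $n\ge N_\alpha$ and $j\ge2$ one has $\lambda_{\alpha,n,j}\in[0,4]$, and $z_{\alpha,n,j}\in[0,\pi]$ is defined by $4\sin^2(z_{\alpha,n,j}/2)=\lambda_{\alpha,n,j}$. A contraction on a closed interval is a map of the interval into itself that is Lipschitz with a constant strictly less than $1$. *)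

theory Defs
  imports
    "HOL-Analysis.Lipschitz"
    "Jordan_Normal_Form.Char_Poly"
begin

text \<open>Rows and columns of the Laplacian are numbered from 1 in \<open>laplacian_entry\<close>, whereas the
  matrices of \<^theory>\<open>Jordan_Normal_Form.Matrix\<close> are indexed from 0. The entries are
  intended for \<open>n \<ge> 3\<close>, where the cases below do not overlap.\<close>

definition laplacian_entry :: "real \<Rightarrow> nat \<Rightarrow> nat \<Rightarrow> nat \<Rightarrow> real" where
  "laplacian_entry \<alpha> n j k =
     (if j = k then (if j = 1 \<or> j = n then 1 + \<alpha> else 2)
      else if j = 1 \<and> k = n \<or> j = n \<and> k = 1 then - \<alpha>
      else if k = j + 1 \<or> j = k + 1 then - 1
      else 0)"

definition laplacian :: "real \<Rightarrow> nat \<Rightarrow> real mat" where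
  "laplacian \<alpha> n = Matrix.mat n n (\<lambda>(j, k). laplacian_entry \<alpha> n (j + 1) (k + 1))"

text \<open>The \<open>j\<close>-th smallest eigenvalue, \<open>1 \<le> j \<le> n\<close>, counted with multiplicity. The Laplacian is
  real symmetric, so its characteristic polynomial has \<open>n\<close> real roots.\<close>

definition lambda :: "real \<Rightarrow> nat \<Rightarrow> nat \<Rightarrow> real" where
  "lambda \<alpha> n j = sorted_list_of_multiset (proots (char_poly (laplacian \<alpha> n))) ! (j - 1)"

definition kappa :: "real \<Rightarrow> real" where
  "kappa \<alpha> = (\<alpha> - 1) / \<alpha>"

definition N_min :: "real \<Rightarrow> int" where
  "N_min \<alpha> = max 3 (\<lfloor>kappa \<alpha>\<rfloor> + 1)"

definition d :: "nat \<Rightarrow> nat \<Rightarrow> real" where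
  "d n j = (real j - 1) * pi / real n"

text \<open>At \<open>pi\<close> the value is the limit from the left; there the library's \<open>tan (pi / 2)\<close> is 0.\<close>

definition eta :: "real \<Rightarrow> real \<Rightarrow> real" where
  "eta \<alpha> x = (if x = pi then 0 else 2 * arctan (kappa \<alpha> * tan (x / 2)) - pi)"

text \<open>Well defined whenever \<open>lambda \<alpha> n j \<in> {0..4}\<close>.\<close>

definition z :: "real \<Rightarrow> nat \<Rightarrow> nat \<Rightarrow> real" where
  "z \<alpha> n j = (THE x. x \<in> {0..pi} \<and> 4 * (sin (x / 2))\<^sup>2 = lambda \<alpha> n j)"

definition contraction_on :: "'a::metric_space set \<Rightarrow> ('a \<Rightarrow> 'a) \<Rightarrow> bool" where
  "contraction_on S f \<longleftrightarrow> f ` S \<subseteq> S \<and> (\<exists>c<1. c-lipschitz_on S f)"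

end

theory Submission
  imports Defs
begin

text \<open>
  The reflection \<open>k \<mapsto> n + 1 - k\<close> commutes with the Laplacian, so eigenvectors can be sought
  among symmetric and antisymmetric sequences. Inside, the eigenvalue equation is the recurrence
  \<open>v (k - 1) + v (k + 1) = (2 - \<mu>) * v k\<close>; with \<open>\<mu> = 4 * (sin (x / 2))\<^sup>2 = 2 - 2 * cos x\<close> it is solved by
  the cosine and the sine of \<open>(k - (n + 1) / 2) * x\<close>, and only the first row remains as a condition
  on \<open>x\<close>. For the cosine it reads \<open>sin (n * x / 2) * sin (x / 2) = 0\<close>, whose solutions in \<open>[0, pi)\<close> are
  the points \<open>d n i\<close> with odd \<open>i\<close>. For the sine it reads \<open>tan (n * x / 2) = kappa \<alpha> * tan (x / 2)\<close>. Taking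
  the arctangent on the branch that belongs to an even \<open>i\<close> turns the latter into the fixed-point
  equation \<open>x = d n i + eta \<alpha> x / n\<close>.

  The derivative of \<open>eta \<alpha>\<close> on \<open>[0, pi)\<close> lies between \<open>0\<close> and \<open>kappa \<alpha>\<close>, and \<open>eta \<alpha>\<close> takes
  values in \<open>[-pi, 0]\<close>. Because \<open>n > kappa \<alpha>\<close>, the right-hand side is a contraction of
  \<open>[d n (i - 1), d n i]\<close> (\<open>fixed_point_map_contraction\<close>), and it has a unique fixed point.

  It remains to see that the fixed point for \<open>j\<close> belongs to the \<open>j\<close>-th eigenvalue and not to another
  one. The points \<open>d n i\<close> for odd \<open>i\<close> and the fixed points for even \<open>i \<ge> 4\<close> interlace and give
  \<open>n - 1\<close> distinct eigenvalues, the smallest of which is 0. For \<open>i = 2\<close> the fixed point is \<open>x = 0\<close>,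
  where the sine vanishes identically. The eigenvalue that it fails to give is negative: replacing
  \<open>x\<close> by \<open>\<i> * x\<close>, the antisymmetric condition becomes \<open>tanh (n * x / 2) = kappa \<alpha> * tanh (x / 2)\<close>,
  which has a positive solution exactly because \<open>1 < kappa \<alpha> < n\<close>
  (\<open>negative_root_char_poly_laplacian\<close>). These are \<open>n\<close> distinct roots of a polynomial of
  degree \<open>n\<close>, hence all of them, and listing them in increasing order puts the fixed point for \<open>j\<close>
  in position \<open>j\<close> (\<open>lambda_at_fixed_point\<close>).
\<close>

section \<open>Eigenvalues from solutions of a three-term recurrence\<close>

text \<open>Adding fictitious entries \<open>v 0\<close> and \<open>v (n + 1)\<close> lets the interior recurrence hold in the two
  boundary rows as well; \<open>left\<close> and \<open>right\<close> express what those rows then require of the added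
  entries.\<close>

lemma root_char_poly_laplacianI:
  fixes v :: "nat \<Rightarrow> real"
  assumes n: "3 \<le> n"
    and rec: "\<And>k. k < n \<Longrightarrow> v k + v (k + 2) = (2 - \<mu>) * v (k + 1)"
    and left: "v 0 = (1 - \<alpha>) * v 1 + \<alpha> * v n"
    and right: "v (n + 1) = (1 - \<alpha>) * v n + \<alpha> * v 1"
    and nz: "v 1 \<noteq> 0"
  shows "poly (char_poly (laplacian \<alpha> n)) \<mu> = 0"
proof -
  have row: "(\<Sum>k\<in>{1..n}. laplacian_entry \<alpha> n (i + 1) k * v k) = \<mu> * v (i + 1)" if i: "i < n" for i
  proof -
    have r: "v i + v (i + 2) = (2 - \<mu>) * v (i + 1)" using rec[OF i] .
    consider "i = 0" | "i = n - 1" | "0 < i" "i < n - 1" using i by linarith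
    then show ?thesis
    proof cases
      case 1
      have "(\<Sum>k\<in>{1..n}. laplacian_entry \<alpha> n (i + 1) k * v k)
            = (\<Sum>k\<in>{1, 2, n}. laplacian_entry \<alpha> n (i + 1) k * v k)"
        using n 1 by (intro sum.mono_neutral_right) (auto simp: laplacian_entry_def)
      also have "\<dots> = (1 + \<alpha>) * v 1 - v 2 - \<alpha> * v n"
        using n 1 by (simp add: laplacian_entry_def)
      also have "\<dots> = \<mu> * v (i + 1)"
        using r left 1 by (simp add: algebra_simps numeral_2_eq_2)
      finally show ?thesis .
    next
      case 2
      have "(\<Sum>k\<in>{1..n}. laplacian_entry \<alpha> n (i + 1) k * v k)
            = (\<Sum>k\<in>{1, n - 1, n}. laplacian_entry \<alpha> n (i + 1) k * v k)"
        using n 2 by (intro sum.mono_neutral_right) (auto simp: laplacian_entry_def)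
      also have "\<dots> = (1 + \<alpha>) * v n - v (n - 1) - \<alpha> * v 1"
        using n 2 by (auto simp: laplacian_entry_def)
      also have "\<dots> = \<mu> * v (i + 1)"
      proof -
        have "i + 1 = n" "i + 2 = n + 1" using n 2 by auto
        then show ?thesis using r right 2 by (simp add: algebra_simps)
      qed
      finally show ?thesis .
    next
      case 3
      have "(\<Sum>k\<in>{1..n}. laplacian_entry \<alpha> n (i + 1) k * v k)
            = (\<Sum>k\<in>{i, i + 1, i + 2}. laplacian_entry \<alpha> n (i + 1) k * v k)"
        using 3 by (intro sum.mono_neutral_right) (auto simp: laplacian_entry_def)
      also have "\<dots> = 2 * v (i + 1) - v i - v (i + 2)"
        using 3 by (auto simp: laplacian_entry_def)
      also have "\<dots> = \<mu> * v (i + 1)"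
        using r by (simp add: algebra_simps)
      finally show ?thesis .
    qed
  qed
  define w where "w = vec n (\<lambda>i. v (i + 1))"
  have A: "laplacian \<alpha> n \<in> carrier_mat n n" by (simp add: laplacian_def)
  have "laplacian \<alpha> n *\<^sub>v w = \<mu> \<cdot>\<^sub>v w"
  proof (rule eq_vecI)
    fix i assume "i < dim_vec (\<mu> \<cdot>\<^sub>v w)"
    then have i: "i < n" by (simp add: w_def)
    have "(laplacian \<alpha> n *\<^sub>v w) $ i = (\<Sum>k = 0..<n. laplacian_entry \<alpha> n (i + 1) (k + 1) * v (k + 1))"
      using i by (simp add: laplacian_def w_def scalar_prod_def)
    also have "\<dots> = (\<Sum>k\<in>{1..n}. laplacian_entry \<alpha> n (i + 1) k * v k)"
      by (rule sum.reindex_bij_witness[of _ "\<lambda>k. k - 1" "\<lambda>k. k + 1"]) auto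
    also have "\<dots> = (\<mu> \<cdot>\<^sub>v w) $ i" using row[OF i] i by (simp add: w_def)
    finally show "(laplacian \<alpha> n *\<^sub>v w) $ i = (\<mu> \<cdot>\<^sub>v w) $ i" .
  qed (simp add: laplacian_def w_def)
  moreover have "w \<noteq> 0\<^sub>v n"
  proof
    assume "w = 0\<^sub>v n"
    then have "w $ 0 = 0" using n by simp
    then show False using nz n by (simp add: w_def)
  qed
  ultimately have "eigenvalue (laplacian \<alpha> n) \<mu>"
    unfolding eigenvalue_def eigenvector_def using A by (intro exI[of _ w]) (auto simp: w_def)
  then show ?thesis using eigenvalue_root_char_poly[OF A] by blast
qed

lemma four_sin_half_squared: "4 * (sin (x / 2))\<^sup>2 = 2 - 2 * cos (x::real)"
  using cos_double_sin[of "x / 2"] by simp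

text \<open>A symmetric vector has equal end entries, so \<open>\<alpha>\<close> drops out of the boundary conditions and
  these become \<open>v 0 = v 1\<close>, that is, \<open>sin (n * x / 2) * sin (x / 2) = 0\<close>.\<close>

lemma root_char_poly_laplacian_symmetric:
  assumes n: "3 \<le> n" and S: "sin (real n * x / 2) = 0" and c: "cos (x / 2) \<noteq> 0"
  shows "poly (char_poly (laplacian \<alpha> n)) (4 * (sin (x / 2))\<^sup>2) = 0"
proof -
  define v where "v k = cos ((real k - (real n + 1) / 2) * x)" for k
  have v0: "v 0 = cos (real n * x / 2 + x / 2)"
    unfolding v_def cos_minus[of "real n * x / 2 + x / 2", symmetric] by (rule arg_cong[of _ _ cos]) (simp add: field_simps)
  have v1: "v 1 = cos (real n * x / 2 - x / 2)"
    unfolding v_def cos_minus[of "real n * x / 2 - x / 2", symmetric] by (rule arg_cong[of _ _ cos]) (simp add: field_simps)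
  have vn: "v n = cos (real n * x / 2 - x / 2)"
    unfolding v_def by (simp add: field_simps)
  have vn1: "v (n + 1) = cos (real n * x / 2 + x / 2)"
    unfolding v_def by (simp add: field_simps)
  show ?thesis
  proof (rule root_char_poly_laplacianI[OF n, where v = v])
    fix k
    define a where "a = (real (k + 1) - (real n + 1) / 2) * x"
    have "v k = cos (a - x)" "v (k + 2) = cos (a + x)" "v (k + 1) = cos a"
      unfolding v_def a_def by (simp_all add: algebra_simps)
    then show "v k + v (k + 2) = (2 - 4 * (sin (x / 2))\<^sup>2) * v (k + 1)"
      by (simp add: four_sin_half_squared cos_add cos_diff)
  next
    have "cos (real n * x / 2) \<noteq> 0" using S sin_cos_squared_add[of "real n * x / 2"] by auto
    then show "v 1 \<noteq> 0" using S c unfolding v1 by (simp add: cos_diff)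
  next
    have "cos (real n * x / 2 + x / 2) = cos (real n * x / 2 - x / 2)"
      by (simp only: cos_add cos_diff S mult_zero_left)
    then show "v 0 = (1 - \<alpha>) * v 1 + \<alpha> * v n" "v (n + 1) = (1 - \<alpha>) * v n + \<alpha> * v 1"
      unfolding v0 v1 vn vn1 by (simp_all add: algebra_simps)
  qed
qed

text \<open>An antisymmetric vector has opposite end entries, so the boundary conditions become
  \<open>v 0 = (1 - 2 * \<alpha>) * v 1\<close>. By the addition theorem this is the equation
  \<open>tan (n * x / 2) = kappa \<alpha> * tan (x / 2)\<close>, here with denominators cleared.\<close>

lemma root_char_poly_laplacian_antisymmetric:
  assumes n: "3 \<le> n" and \<alpha>: "\<alpha> \<noteq> 0"
    and eq: "sin (real n * x / 2) * cos (x / 2) = kappa \<alpha> * (cos (real n * x / 2) * sin (x / 2))"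
    and c: "cos (x / 2) \<noteq> 0" and s: "sin (x / 2) \<noteq> 0"
  shows "poly (char_poly (laplacian \<alpha> n)) (4 * (sin (x / 2))\<^sup>2) = 0"
proof -
  define v where "v k = sin ((real k - (real n + 1) / 2) * x)" for k
  have v0: "v 0 = - sin (real n * x / 2 + x / 2)"
    unfolding v_def sin_minus[symmetric] by (rule arg_cong[of _ _ sin]) (simp add: field_simps)
  have v1: "v 1 = - sin (real n * x / 2 - x / 2)"
    unfolding v_def sin_minus[symmetric] by (rule arg_cong[of _ _ sin]) (simp add: field_simps)
  have vn: "v n = sin (real n * x / 2 - x / 2)"
    unfolding v_def by (simp add: field_simps)
  have vn1: "v (n + 1) = sin (real n * x / 2 + x / 2)"
    unfolding v_def by (simp add: field_simps)
  have eq': "\<alpha> * (sin (real n * x / 2) * cos (x / 2)) = (\<alpha> - 1) * (cos (real n * x / 2) * sin (x / 2))"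
    using eq \<alpha> by (simp add: kappa_def field_simps)
  have key: "sin (real n * x / 2 + x / 2) = (1 - 2 * \<alpha>) * sin (real n * x / 2 - x / 2)"
    using eq' unfolding sin_add sin_diff by (simp add: algebra_simps)
  show ?thesis
  proof (rule root_char_poly_laplacianI[OF n, where v = v])
    fix k
    define a where "a = (real (k + 1) - (real n + 1) / 2) * x"
    have "v k = sin (a - x)" "v (k + 2) = sin (a + x)" "v (k + 1) = sin a"
      unfolding v_def a_def by (simp_all add: algebra_simps)
    then show "v k + v (k + 2) = (2 - 4 * (sin (x / 2))\<^sup>2) * v (k + 1)"
      by (simp add: four_sin_half_squared sin_add sin_diff)
  next
    show "v 1 \<noteq> 0"
    proof
      assume "v 1 = 0"
      then have "sin (real n * x / 2 - x / 2) = 0" "sin (real n * x / 2 + x / 2) = 0"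
        using key v1 by auto
      then have "sin (real n * x / 2) * cos (x / 2) = 0" "cos (real n * x / 2) * sin (x / 2) = 0"
        unfolding sin_add sin_diff by linarith+
      then have "sin (real n * x / 2) = 0" "cos (real n * x / 2) = 0" using s c by auto
      then show False using sin_cos_squared_add[of "real n * x / 2"] by simp
    qed
  qed (simp_all only: v0 v1 vn vn1 key, simp_all add: algebra_simps)
qed

text \<open>The antisymmetric case at an imaginary argument \<open>\<i> * x\<close>.\<close>

lemma root_char_poly_laplacian_hyperbolic:
  assumes n: "3 \<le> n"
    and key: "sinh ((real n + 1) * x / 2) = (1 - 2 * \<alpha>) * sinh ((real n - 1) * x / 2)"
    and x: "0 < x"
  shows "poly (char_poly (laplacian \<alpha> n)) (2 - 2 * cosh x) = 0"
proof -
  define v where "v k = sinh ((real k - (real n + 1) / 2) * x)" for k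
  have v0: "v 0 = - sinh ((real n + 1) * x / 2)"
    unfolding v_def sinh_minus[symmetric] by (rule arg_cong[of _ _ sinh]) (simp add: field_simps)
  have v1: "v 1 = - sinh ((real n - 1) * x / 2)"
    unfolding v_def sinh_minus[symmetric] by (rule arg_cong[of _ _ sinh]) (simp add: field_simps)
  have vn: "v n = sinh ((real n - 1) * x / 2)"
    unfolding v_def by (simp add: field_simps)
  have vn1: "v (n + 1) = sinh ((real n + 1) * x / 2)"
    unfolding v_def by (simp add: field_simps)
  show ?thesis
  proof (rule root_char_poly_laplacianI[OF n, where v = v])
    fix k
    define a where "a = (real (k + 1) - (real n + 1) / 2) * x"
    have "v k = sinh (a - x)" "v (k + 2) = sinh (a + x)" "v (k + 1) = sinh a"
      unfolding v_def a_def by (simp_all add: algebra_simps)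
    then show "v k + v (k + 2) = (2 - (2 - 2 * cosh x)) * v (k + 1)"
      by (simp add: sinh_add sinh_diff)
  next
    show "v 1 \<noteq> 0" unfolding v1 using n x by simp
  qed (simp_all only: v0 v1 vn vn1 key, simp_all add: algebra_simps)
qed

text \<open>The intermediate value theorem is applied to the difference \<open>g\<close> of the two sides of the
  hyperbolic condition. It vanishes at 0 with slope \<open>1 + \<alpha> * (n - 1)\<close>, which is negative exactly
  when \<open>kappa \<alpha> < n\<close>.\<close>

lemma negative_root_char_poly_laplacian:
  assumes n: "3 \<le> n" and \<alpha>: "\<alpha> < 0" and n\<kappa>: "kappa \<alpha> < real n"
  obtains \<mu> where "\<mu> < 0" "poly (char_poly (laplacian \<alpha> n)) \<mu> = 0"
proof -
  define g where "g x = sinh ((real n + 1) * x / 2) - (1 - 2 * \<alpha>) * sinh ((real n - 1) * x / 2)" for x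
  have "1 < - \<alpha> * (real n - 1)"
    using n\<kappa> \<alpha> by (simp add: kappa_def field_simps)
  then have slope: "1 + \<alpha> * (real n - 1) < 0" by (simp add: algebra_simps)
  have "(g has_real_derivative (1 + \<alpha> * (real n - 1))) (at 0)"
    unfolding g_def by (rule derivative_eq_intros refl | simp add: field_simps)+
  then obtain e where e: "e > 0" "\<And>h. 0 < h \<Longrightarrow> h < e \<Longrightarrow> g (0 + h) < g 0"
    using DERIV_neg_dec_right[OF _ slope] by blast
  \<comment> \<open>With \<open>cosh b = 1 - 2 * \<alpha>\<close> the addition theorem for \<open>sinh\<close> makes the subtracted term of
    \<open>g b\<close> cancel, and a positive rest remains.\<close>
  define b where "b = arcosh (1 - 2 * \<alpha>)"
  have cb: "cosh b = 1 - 2 * \<alpha>" unfolding b_def using \<alpha> by (intro cosh_arcosh_real) simp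
  have b: "b > 0" proof -
    have "b \<noteq> 0" using cb \<alpha> by auto
    moreover have "b \<ge> 0" unfolding b_def using \<alpha> by (intro arcosh_nonneg_real) simp
    ultimately show ?thesis by simp
  qed
  have gb: "g b > 0"
  proof -
    have "sinh ((real n + 1) * b / 2) = sinh ((real n - 1) * b / 2 + b)"
      by (simp add: field_simps)
    also have "\<dots> = (1 - 2 * \<alpha>) * sinh ((real n - 1) * b / 2) + cosh ((real n - 1) * b / 2) * sinh b"
      by (simp add: sinh_add cb)
    finally show ?thesis unfolding g_def using b by (simp add: cosh_real_pos)
  qed
  define a where "a = min b e / 2"
  have a: "0 < a" "a < b" "a < e" unfolding a_def using b e(1) by auto
  have ga: "g a < 0" using e(2)[OF a(1,3)] by (simp add: g_def)
  have "\<exists>x\<ge>a. x \<le> b \<and> g x = 0"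
  proof (rule IVT')
    show "continuous_on {a..b} g" unfolding g_def by (intro continuous_intros) auto
  qed (use ga gb a in auto)
  then obtain x where x: "a \<le> x" "g x = 0" by blast
  show thesis
  proof (rule that)
    show "2 - 2 * cosh x < 0" using x a cosh_real_strict_mono[of 0 x] by simp
    show "poly (char_poly (laplacian \<alpha> n)) (2 - 2 * cosh x) = 0"
      using x a n by (intro root_char_poly_laplacian_hyperbolic) (auto simp: g_def)
  qed
qed

section \<open>The fixed-point equation\<close>

lemma kappa_gt_1: "\<alpha> < 0 \<Longrightarrow> 1 < kappa \<alpha>"
  by (simp add: kappa_def field_simps)

lemma eta_bounds:
  assumes "\<alpha> < 0" "0 \<le> x" "x < pi"
  shows "- pi \<le> eta \<alpha> x" "eta \<alpha> x < 0" "0 < x \<Longrightarrow> - pi < eta \<alpha> x"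
proof -
  have k: "kappa \<alpha> > 0" using kappa_gt_1[OF assms(1)] by simp
  have t: "tan (x / 2) \<ge> 0"
    using assms tan_gt_zero[of "x / 2"] by (cases "x = 0") auto
  show "- pi \<le> eta \<alpha> x" using assms k t by (simp add: eta_def)
  show "eta \<alpha> x < 0" using assms arctan_ubound[of "kappa \<alpha> * tan (x / 2)"] by (simp add: eta_def)
  assume "0 < x"
  then have "tan (x / 2) > 0" using assms by (intro tan_gt_zero) auto
  then show "- pi < eta \<alpha> x" using assms k by (simp add: eta_def)
qed

text \<open>With \<open>t = tan (x / 2)\<close> the derivative is \<open>kappa \<alpha> * (1 + t\<^sup>2) / (1 + (kappa \<alpha>)\<^sup>2 * t\<^sup>2)\<close>, which
  is at most \<open>kappa \<alpha>\<close> because \<open>kappa \<alpha> \<ge> 1\<close>.\<close>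

lemma eta_lipschitz:
  assumes \<alpha>: "\<alpha> < 0"
  shows "(kappa \<alpha>)-lipschitz_on {0..<pi} (eta \<alpha>)"
proof -
  define g where "g x = 2 * arctan (kappa \<alpha> * tan (x / 2)) - pi" for x
  define g' where "g' x = kappa \<alpha> * (inverse ((cos (x / 2))\<^sup>2) / (1 + (kappa \<alpha> * tan (x / 2))\<^sup>2))" for x
  have k: "1 < kappa \<alpha>" using kappa_gt_1[OF \<alpha>] .
  have c: "cos (x / 2) \<noteq> 0" if "x \<in> {0..<pi}" for x
    using that cos_gt_zero_pi[of "x / 2"] by auto
  have der: "(g has_field_derivative g' x) (at x within {0..<pi})" if "x \<in> {0..<pi}" for x
    unfolding g_def g'_def using c[OF that]
    by (auto intro!: derivative_eq_intros simp: inverse_eq_divide)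
  have bound: "norm (g' x) \<le> kappa \<alpha>" if "x \<in> {0..<pi}" for x
  proof -
    have "inverse ((cos (x / 2))\<^sup>2) = 1 + (tan (x / 2))\<^sup>2"
      using tan_sec[OF c[OF that]] by (simp add: power_inverse)
    also have "\<dots> \<le> 1 + (kappa \<alpha> * tan (x / 2))\<^sup>2"
      using k by (simp add: power_mult_distrib mult_le_cancel_right1 one_le_power)
    finally have "inverse ((cos (x / 2))\<^sup>2) / (1 + (kappa \<alpha> * tan (x / 2))\<^sup>2) \<le> 1"
      by (simp add: divide_le_eq add_pos_nonneg)
    then have "g' x \<le> kappa \<alpha>" unfolding g'_def using k by (intro mult_left_le) auto
    moreover have "0 \<le> g' x" unfolding g'_def using k by simp
    ultimately show ?thesis by simp
  qed
  have "norm (g x - g y) \<le> kappa \<alpha> * norm (x - y)" if "x \<in> {0..<pi}" "y \<in> {0..<pi}" for x y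
    using field_differentiable_bound[OF _ der bound that] by simp
  then show ?thesis
    using k by (intro lipschitz_onI) (auto simp: dist_norm eta_def g_def)
qed

lemma d_bounds:
  assumes "1 \<le> j" "j \<le> n"
  shows "0 \<le> d n j" "d n j < pi"
proof -
  show "0 \<le> d n j" using assms by (simp add: d_def)
  have "(real j - 1) * pi < real n * pi" using assms by (intro mult_strict_right_mono) auto
  then show "d n j < pi" using assms by (simp add: d_def divide_less_eq mult.commute)
qed

lemma d_step: "d n (j + 1) = d n j + pi / real n"
  by (simp add: d_def algebra_simps diff_divide_distrib add_divide_distrib)

text \<open>The interval has length \<open>pi / n\<close> and ends at \<open>d n j\<close>, so \<open>-pi \<le> eta \<alpha> x \<le> 0\<close> says precisely that
  it is mapped into itself.\<close>

lemma fixed_point_map_contraction: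
  assumes \<alpha>: "\<alpha> < 0" and n\<kappa>: "kappa \<alpha> < real n" and j: "2 \<le> j" "j \<le> n"
  shows "contraction_on {d n (j - 1)..d n j} (\<lambda>x. d n j + eta \<alpha> x / real n)"
proof -
  let ?S = "{d n (j - 1)..d n j}"
  have n: "0 < n" using j by simp
  have sub: "?S \<subseteq> {0..<pi}" using j d_bounds(1)[of "j - 1" n] d_bounds(2)[of j n] by fastforce
  have step: "d n j = d n (j - 1) + pi / real n" using d_step[of n "j - 1"] j by simp
  have "d n j + eta \<alpha> x / real n \<in> ?S" if "x \<in> ?S" for x
  proof -
    have x: "0 \<le> x" "x < pi" using sub that by auto
    have "- (pi / real n) \<le> eta \<alpha> x / real n" "eta \<alpha> x / real n \<le> 0"
      using eta_bounds(1,2)[OF \<alpha> x] n by (simp_all add: field_simps)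
    then show ?thesis using step by auto
  qed
  moreover have "(kappa \<alpha> / real n)-lipschitz_on ?S (\<lambda>x. d n j + eta \<alpha> x / real n)"
  proof (rule lipschitz_onI)
    fix x y assume "x \<in> ?S" "y \<in> ?S"
    then have "dist (eta \<alpha> x) (eta \<alpha> y) \<le> kappa \<alpha> * dist x y"
      using sub by (intro lipschitz_onD[OF eta_lipschitz[OF \<alpha>]]) auto
    then have "\<bar>eta \<alpha> x - eta \<alpha> y\<bar> / real n \<le> kappa \<alpha> * dist x y / real n"
      by (intro divide_right_mono) (auto simp: dist_real_def)
    then show "dist (d n j + eta \<alpha> x / real n) (d n j + eta \<alpha> y / real n) \<le> kappa \<alpha> / real n * dist x y"
      by (simp add: dist_real_def flip: diff_divide_distrib)
  qed (use kappa_gt_1[OF \<alpha>] in simp)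
  moreover have "kappa \<alpha> / real n < 1" using n\<kappa> n by simp
  ultimately show ?thesis unfolding contraction_on_def by blast
qed

lemma contraction_on_unique_fixed_point:
  fixes f :: "'a::metric_space \<Rightarrow> 'a"
  assumes "contraction_on S f" "complete S" "S \<noteq> {}"
  shows "\<exists>!x. x \<in> S \<and> f x = x"
proof -
  obtain c where c: "c < 1" "c-lipschitz_on S f" and S: "f ` S \<subseteq> S"
    using assms(1) unfolding contraction_on_def by blast
  show ?thesis
    by (rule Banach_fix[OF assms(2,3) lipschitz_on_nonneg[OF c(2)] c(1) S])
       (use lipschitz_onD[OF c(2)] in blast)
qed

text \<open>The fixed-point equation says that \<open>n * x / 2\<close> and \<open>arctan (kappa \<alpha> * tan (x / 2))\<close> differ by
  \<open>(j - 2) * pi / 2\<close>. This is a multiple of \<open>pi\<close> for even \<open>j\<close>, hence the two angles have the same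
  tangent.\<close>

lemma fixed_point_root_char_poly:
  assumes n: "3 \<le> n" and \<alpha>: "\<alpha> < 0" and j: "even j" "2 \<le> j"
    and x: "0 < x" "x < pi" and fp: "d n j + eta \<alpha> x / real n = x"
  shows "poly (char_poly (laplacian \<alpha> n)) (4 * (sin (x / 2))\<^sup>2) = 0"
proof (rule root_char_poly_laplacian_antisymmetric[OF n])
  have s: "sin (x / 2) > 0" using x by (intro sin_gt_zero) auto
  have c: "cos (x / 2) > 0" using x by (intro cos_gt_zero_pi) auto
  define \<theta> where "\<theta> = arctan (kappa \<alpha> * tan (x / 2))"
  obtain m where m: "j = 2 * m + 2"
    using j by (metis evenE add.commute dvd_add_right_iff dvd_refl le_iff_add)
  have "real n * x = real n * d n j + eta \<alpha> x" using fp n by (auto simp: field_simps)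
  also have "\<dots> = (real j - 1) * pi + (2 * \<theta> - pi)"
    using n x by (simp add: d_def eta_def \<theta>_def)
  finally have angle: "real n * x / 2 = \<theta> + real m * pi" by (simp add: m field_simps)
  have SC: "sin (real n * x / 2) = (-1) ^ m * sin \<theta>" "cos (real n * x / 2) = (-1) ^ m * cos \<theta>"
    unfolding angle by (simp_all add: sin_add cos_add)
  have "sin \<theta> = kappa \<alpha> * tan (x / 2) * cos \<theta>"
  proof -
    have "tan \<theta> = kappa \<alpha> * tan (x / 2)" "cos \<theta> \<noteq> 0" by (simp_all add: \<theta>_def tan_arctan)
    then show ?thesis by (metis nonzero_eq_divide_eq tan_def)
  qed
  then show "sin (real n * x / 2) * cos (x / 2) = kappa \<alpha> * (cos (real n * x / 2) * sin (x / 2))"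
    using c by (simp add: SC tan_def)
  show "cos (x / 2) \<noteq> 0" "sin (x / 2) \<noteq> 0" using s c by auto
  show "\<alpha> \<noteq> 0" using \<alpha> by simp
qed

section \<open>Ordering the eigenvalues\<close>

text \<open>As many distinct roots as the degree leave no room for multiplicities or further roots.\<close>

lemma sorted_proots_eqI:
  fixes p :: "'a::{idom,linorder} poly"
  assumes sorted: "sorted_wrt (<) xs" and p: "p \<noteq> 0" and len: "length xs = degree p"
    and roots: "\<And>x. x \<in> set xs \<Longrightarrow> poly p x = 0"
  shows "sorted_list_of_multiset (proots p) = xs"
proof -
  have dist: "sorted xs" "distinct xs" using sorted by (simp_all add: strict_sorted_iff)
  have "mset xs \<subseteq># proots p"
  proof (rule mset_subset_eqI)
    fix a
    have "1 \<le> order a p" if "a \<in> set xs" using roots[OF that] p by (simp add: order_root Suc_le_eq)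
    then show "count (mset xs) a \<le> count (proots p) a"
      using p dist(2) by (auto simp: distinct_count_atmost_1)
  qed
  moreover have "size (proots p) \<le> size (mset xs)"
    using size_proots_le[of p] len by simp
  ultimately have "mset xs = proots p"
    by (meson leD mset_subset_size subset_mset.le_imp_less_or_eq)
  then have "sorted_list_of_multiset (proots p) = sorted_list_of_multiset (mset xs)" by simp
  also have "\<dots> = xs" using dist(1) by (simp add: sort_key_id_if_sorted)
  finally show ?thesis .
qed

lemma four_sin_half_squared_strict_mono:
  assumes "0 \<le> x" "x < y" "y \<le> (pi::real)"
  shows "4 * (sin (x / 2))\<^sup>2 < 4 * (sin (y / 2))\<^sup>2"
  using cos_monotone_0_pi[OF assms] by (simp add: four_sin_half_squared)

text \<open>All eigenvalues have to be found at once, since the position of one of them in the sorted list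
  is determined only by the others.\<close>

lemma lambda_at_fixed_point:
  assumes n: "3 \<le> n" and \<alpha>: "\<alpha> < 0" and n\<kappa>: "kappa \<alpha> < real n"
    and j: "even j" "4 \<le> j" "j \<le> n"
    and x: "x \<in> {d n (j - 1)..d n j}" "d n j + eta \<alpha> x / real n = x"
  shows "lambda \<alpha> n j = 4 * (sin (x / 2))\<^sup>2"
proof -
  let ?p = "char_poly (laplacian \<alpha> n)"
  let ?I = "\<lambda>i. {d n (i - 1)..d n i}"
  let ?f = "\<lambda>i x. d n i + eta \<alpha> x / real n"
  have uniq: "\<exists>!x. x \<in> ?I i \<and> ?f i x = x" if i: "4 \<le> i" "i \<le> n" for i
  proof -
    have "contraction_on (?I i) (?f i)"
      using i by (intro fixed_point_map_contraction[OF \<alpha> n\<kappa>]) auto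
    moreover have "?I i \<noteq> {}" using d_step[of n "i - 1"] i n by simp
    ultimately show ?thesis
      by (intro contraction_on_unique_fixed_point compact_imp_complete compact_Icc)
  qed
  \<comment> \<open>\<open>X i\<close> is the angle of the \<open>i\<close>-th eigenvalue for \<open>2 \<le> i \<le> n\<close>. The angle of the eigenvalue 0,
    which the constant vectors produce, takes the place of the trivial fixed point at \<open>i = 2\<close>.\<close>
  define X where "X i = (if i = 2 then 0 else if odd i then d n i
                         else (THE x. x \<in> ?I i \<and> ?f i x = x))" for i
  have X: "X i \<in> ?I i" "?f i (X i) = X i" if i: "even i" "4 \<le> i" "i \<le> n" for i
  proof -
    from theI'[OF uniq[OF i(2,3)]] show "X i \<in> ?I i" "?f i (X i) = X i" using i by (auto simp: X_def)
  qed
  have Xj: "X j = x"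
    using uniq[OF j(2,3)] X[OF j] x by blast
  \<comment> \<open>\<open>upper\<close> and \<open>lower\<close> together say that the points \<open>d n i\<close> separate the angles.\<close>
  have upper: "X i \<le> d n i" if i: "2 \<le> i" "i \<le> n" for i
  proof (cases "even i \<and> i \<noteq> 2")
    case True
    then have "4 \<le> i" using i by presburger
    then show ?thesis using X(1)[of i] True i by auto
  qed (use i d_bounds[of i n] in \<open>auto simp: X_def\<close>)
  have lower: "d n i < X (i + 1)" if i: "2 \<le> i" "i < n" for i
  proof (cases "odd (i + 1)")
    case True
    then show ?thesis using i d_step[of n i] by (auto simp: X_def)
  next
    case False
    then have i': "even (i + 1)" "4 \<le> i + 1" "i + 1 \<le> n" using i by presburger+
    have "0 < d n i" using i by (simp add: d_def)
    then have "0 < X (i + 1)" "X (i + 1) < pi"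
      using X(1)[OF i'] d_bounds(2)[of "i + 1" n] i by auto
    then have "- pi < eta \<alpha> (X (i + 1))" using eta_bounds(3)[OF \<alpha>] by simp
    then have "- (pi / real n) < eta \<alpha> (X (i + 1)) / real n" using n by (simp add: field_simps)
    then show ?thesis using X(2)[OF i'] d_step[of n i] i by linarith
  qed
  have X0: "0 \<le> X i" if i: "2 \<le> i" "i \<le> n" for i
  proof (cases "i = 2")
    case False
    then have "d n (i - 1) < X i" using lower[of "i - 1"] i by auto
    then show ?thesis using d_bounds(1)[of "i - 1" n] i by fastforce
  qed (simp add: X_def)
  have Xpi: "X i < pi" if i: "2 \<le> i" "i \<le> n" for i
    using upper[OF i] d_bounds(2)[of i n] i by linarith
  obtain \<mu> where \<mu>: "\<mu> < 0" "poly ?p \<mu> = 0"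
    using negative_root_char_poly_laplacian[OF n \<alpha> n\<kappa>] by blast
  \<comment> \<open>List positions start at 0, so \<open>Y i\<close> is the eigenvalue of index \<open>i + 1\<close>.\<close>
  define Y where "Y i = (if i = 0 then \<mu> else 4 * (sin (X (i + 1) / 2))\<^sup>2)" for i
  have root: "poly ?p (Y i) = 0" if i: "i < n" for i
  proof -
    have "i = 0 \<or> even (i + 1) \<and> 4 \<le> i + 1 \<or> i = 1 \<or> odd (i + 1) \<and> 2 \<le> i" by presburger
    then consider "i = 0" | "even (i + 1)" "4 \<le> i + 1" | "i = 1" | "odd (i + 1)" "2 \<le> i"
      by blast
    then show ?thesis
    proof cases
      case 1
      then show ?thesis using \<mu> by (simp add: Y_def)
    next
      case 2
      have "0 < X (i + 1)" using lower[of i] d_bounds(1)[of i n] i 2 by auto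
      then show ?thesis
        using 2 i X(2)[OF 2] Xpi[of "i + 1"] fixed_point_root_char_poly[OF n \<alpha>, of "i + 1" "X (i + 1)"]
        by (auto simp: Y_def)
    next
      case 3
      then show ?thesis using root_char_poly_laplacian_symmetric[OF n, of 0]
        by (simp add: Y_def X_def numeral_2_eq_2)
    next
      case 4
      then obtain m where m: "i = 2 * m" by auto
      have "real n * d n (i + 1) / 2 = real m * pi" using n by (simp add: d_def m)
      then have "sin (real n * d n (i + 1) / 2) = 0" by simp
      moreover have "cos (d n (i + 1) / 2) \<noteq> 0"
        using d_bounds[of "i + 1" n] i cos_gt_zero_pi[of "d n (i + 1) / 2"] by auto
      ultimately have "poly ?p (4 * (sin (d n (i + 1) / 2))\<^sup>2) = 0"
        by (intro root_char_poly_laplacian_symmetric[OF n])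
      then show ?thesis using 4 by (simp add: Y_def X_def)
    qed
  qed
  have A: "laplacian \<alpha> n \<in> carrier_mat n n" by (simp add: laplacian_def)
  have "sorted_list_of_multiset (proots ?p) = map Y [0..<n]"
  proof (rule sorted_proots_eqI)
    show "?p \<noteq> 0" "length (map Y [0..<n]) = degree ?p"
      using degree_monic_char_poly[OF A] by auto
    show "poly ?p y = 0" if "y \<in> set (map Y [0..<n])" for y
      using that root by auto
    have "Y i < Y (i + 1)" if i: "i + 1 < n" for i
    proof (cases "i = 0")
      case True
      then show ?thesis using \<mu> by (simp add: Y_def X_def)
    next
      case False
      then have "X (i + 1) < X (i + 2)" using upper[of "i + 1"] lower[of "i + 1"] i by simp
      then show ?thesis
        using False i X0[of "i + 1"] Xpi[of "i + 2"]
          four_sin_half_squared_strict_mono[of "X (i + 1)" "X (i + 2)"]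
        by (simp add: Y_def)
    qed
    then show "sorted_wrt (<) (map Y [0..<n])"
      by (auto simp: sorted_wrt_iff_nth_Suc_transp)
  qed
  then have "lambda \<alpha> n j = Y (j - 1)" unfolding lambda_def using j by simp
  then show ?thesis using j Xj by (simp add: Y_def)
qed

theorem theorem4p2:
  fixes \<alpha> :: real and n j :: nat
  assumes "\<alpha> < 0" and "int n \<ge> N_min \<alpha>" and "even j" and "4 \<le> j" and "j \<le> n"
  shows "contraction_on {d n (j - 1)..d n j} (\<lambda>x. d n j + eta \<alpha> x / real n) \<and>
         {x \<in> {d n (j - 1)..d n j}. d n j + eta \<alpha> x / real n = x} = {z \<alpha> n j}"
proof
  let ?S = "{d n (j - 1)..d n j}"
  let ?f = "\<lambda>x. d n j + eta \<alpha> x / real n"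
  have n: "3 \<le> n" using assms by simp
  have n\<kappa>: "kappa \<alpha> < real n" using assms(2) unfolding N_min_def by linarith
  show contr: "contraction_on ?S ?f"
    using assms by (intro fixed_point_map_contraction n\<kappa>) auto
  have "?S \<noteq> {}" using d_step[of n "j - 1"] assms n by simp
  then have uniq: "\<exists>!x. x \<in> ?S \<and> ?f x = x"
    by (intro contraction_on_unique_fixed_point[OF contr] compact_imp_complete compact_Icc)
  then obtain x where fp: "x \<in> ?S" "?f x = x" by blast
  have x0: "0 \<le> x" "x \<le> pi"
    using fp(1) d_bounds(1)[of "j - 1" n] d_bounds(2)[of j n] assms by fastforce+
  have lam: "lambda \<alpha> n j = 4 * (sin (x / 2))\<^sup>2"
    using assms n fp n\<kappa> by (intro lambda_at_fixed_point) auto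
  have "z \<alpha> n j = x" unfolding z_def
  proof (rule the_equality)
    show "x \<in> {0..pi} \<and> 4 * (sin (x / 2))\<^sup>2 = lambda \<alpha> n j" using x0 lam by simp
    show "y = x" if "y \<in> {0..pi} \<and> 4 * (sin (y / 2))\<^sup>2 = lambda \<alpha> n j" for y
      using that x0 lam four_sin_half_squared_strict_mono[of x y]
        four_sin_half_squared_strict_mono[of y x] by (cases x y rule: linorder_cases) auto
  qed
  then show "{x \<in> ?S. ?f x = x} = {z \<alpha> n j}" using uniq fp by blast
qed

end
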